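(* As formal power series in $q$, \[ \sum_{n\ge0}b_2''(n)q^n=\frac{q+q^2+q^3-q^4}{(1-q)(1+q^2)(1+q+q^2)}+\frac{q}{1+q^2}\sum_{n\ge0}\chi(n)q^{\binom{n+1}{2}}, \] where $\chi(n)=-1$ if $n\equiv0,1\pmod4$ and $\chi(n)=1$ if $n\equiv2,3\pmod4$. Consequently, for any positive integer $n$, we have $b_2''(n)\in\{-1,0,1,2\}$.
   Context: Notation: $(x;q^2)_0=1$ and $(x;q^2)_n=\prod_{j=0}^{n-1}(1-xq^{2j})$. Consider partitions of $n$ for which there are integers $l\ge2$, $1\le k\le l-1$ such that: there are exactly $l-1$ parts equal to $1$; the smallest even part is $2k$; every part greater than $1$ lies in the interval $[2k,2l-1]$; and the odd parts greater than $1$ are distinct. Then $b_2''(n)$ is the signed count of these partitions in which each partition is weighted by $(-1)^{j+1}$, where $j$ is its number of parts greater than $1$. Equivalently, \[ \sum_{n\ge0}b_2''(n)q^n=\sum_{\substack{l\ge2\\1\le k\le l-1}}\frac{(q^{2k+1};q^2)_{l-k}}{(-q^{2k};q^2)_{l-k}}q^{2k+l-1}. \] *)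

theory Defs
  imports "HOL-Library.Multiset" "HOL-Computational_Algebra.Formal_Power_Series"
begin

definition partition_of :: "nat \<Rightarrow> nat multiset \<Rightarrow> bool" where
  "partition_of n P \<longleftrightarrow> 0 \<notin># P \<and> sum_mset P = n"

definition b2pp_admissible :: "nat \<Rightarrow> nat \<Rightarrow> nat multiset \<Rightarrow> bool" where
  "b2pp_admissible l k P \<longleftrightarrow>
     l \<ge> 2 \<and> 1 \<le> k \<and> k \<le> l - 1 \<and>
     count P 1 = l - 1 \<and>
     (2 * k \<in># P \<and> (\<forall>x \<in># P. even x \<longrightarrow> 2 * k \<le> x)) \<and>
     (\<forall>x \<in># P. x > 1 \<longrightarrow> x \<in> {2 * k .. 2 * l - 1}) \<and>
     (\<forall>x \<in># P. x > 1 \<and> odd x \<longrightarrow> count P x = 1)"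

definition b2pp_partitions :: "nat \<Rightarrow> nat multiset set" where
  "b2pp_partitions n = {P. partition_of n P \<and> (\<exists>l k. b2pp_admissible l k P)}"

text \<open>The coefficient \<open>b\<^sub>2''(n)\<close>. By \<open>finite_b2pp_partitions\<close> below the index set is
  finite, so the sum is a genuine one.\<close>

definition b2pp :: "nat \<Rightarrow> int" where
  "b2pp n = (\<Sum>P \<in> b2pp_partitions n. (-1) ^ (size {#x \<in># P. x > 1#} + 1))"

definition chi :: "nat \<Rightarrow> int" where
  "chi n = (if n mod 4 \<in> {0, 1} then -1 else 1)"

lemma finite_partition_of: "finite {P. partition_of n P}"
proof -
  have "{P. partition_of n P} \<subseteq> mset ` {xs. set xs \<subseteq> {..n} \<and> length xs \<le> n}"
  proof
    fix P assume "P \<in> {P. partition_of n P}"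
    hence P: "0 \<notin># P" "sum_mset P = n" by (auto simp: partition_of_def)
    obtain xs where xs: "mset xs = P" using ex_mset by blast
    have len: "size M \<le> sum_mset M" if "0 \<notin># M" for M :: "nat multiset"
      using that by (induction M) auto
    have "x \<le> n" if "x \<in># P" for x
      using P that by (auto dest!: multi_member_split)
    hence "set xs \<subseteq> {..n}" "length xs \<le> n"
      using P xs len[of P] by auto
    thus "P \<in> mset ` {xs. set xs \<subseteq> {..n} \<and> length xs \<le> n}" using xs by blast
  qed
  thus ?thesis by (rule finite_subset) (simp add: finite_lists_length_le)
qed

lemma finite_b2pp_partitions: "finite (b2pp_partitions n)"
  unfolding b2pp_partitions_def by (rule finite_subset[OF _ finite_partition_of[of n]]) auto

text \<open>Infinite sums of formal power series are taken in the \<open>q\<close>-adic topology, and \<open>suminf\<close>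
  returns a junk value on divergent series. The following lemma shows that the theta series
  does converge.\<close>

lemma summable_theta:
  "summable (\<lambda>n. of_int (chi n) * fps_X ^ (Suc n choose 2) :: rat fps)"
proof -
  let ?f = "\<lambda>n. of_int (chi n) * fps_X ^ (Suc n choose 2) :: rat fps"
  let ?S = "Abs_fps (\<lambda>m. \<Sum>n\<le>m. fps_nth (?f n) m)"
  have ge: "n \<le> (Suc n choose 2)" for n by (induction n) (auto simp: numeral_2_eq_2)
  have z: "fps_nth (?f n) m = 0" if "m < n" for n m
    using that ge[of n] by (simp add: fps_of_int[symmetric] fps_X_power_nth)
  have "(\<lambda>N. \<Sum>n<N. ?f n) \<longlonglongrightarrow> ?S"
  proof (rule tendsto_fpsI)
    fix m
    show "eventually (\<lambda>N. fps_nth (\<Sum>n<N. ?f n) m = fps_nth ?S m) sequentially"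
    proof (rule eventually_sequentiallyI[of "Suc m"])
      fix N assume "Suc m \<le> N"
      hence "(\<Sum>n<N. fps_nth (?f n) m) = (\<Sum>n\<le>m. fps_nth (?f n) m)"
        by (intro sum.mono_neutral_right ballI z) auto
      thus "fps_nth (\<Sum>n<N. ?f n) m = fps_nth ?S m"
        by (simp add: fps_sum_nth)
    qed
  qed
  thus ?thesis unfolding summable_def sums_def by blast
qed

end

theory Submission
  imports Defs
begin

text \<open>
Write \<open>q\<close> for the formal variable and group the partitions by the number \<open>L = l - 1\<close> of ones. The
signed generating function of the parts above \<open>1\<close>, summed over all admissible smallest even parts, is
\<open>T\<^sub>L = (\<Sum>k=1..L. q\<^bsup>2k\<^esup> (\<Prod>j=k..L. (1 - q\<^bsup>2j+1\<^esup>) / (1 + q\<^bsup>2j\<^esup>)))\<close>, and the series wanted is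
\<open>\<Sum>L. q\<^bsup>L\<^esup> T\<^sub>L\<close>.

The inhomogeneous first-order recurrence of \<open>T\<^sub>L\<close> in \<open>L\<close> has the particular solution
\<open>q (1 - q\<^bsup>2L+1\<^esup>) / (1 + q)\<close>, so \<open>T\<^sub>L\<close> is this minus a multiple of the solution of the homogeneous
recurrence, the single product \<open>\<Prod>j=1..L. (1 - q\<^bsup>2j+1\<^esup>) / (1 + q\<^bsup>2j\<^esup>)\<close>
(\<open>large_parts_gf_closed_form\<close>). Summed against \<open>q\<^bsup>L\<^esup>\<close>, the particular solution gives two geometric
series. The product gives a basic hypergeometric series to which the Rogers-Fine identity applies;
Fine's iteration (\<open>fine_series_rec\<close>) turns it into a sparse series whose exponents are triangular
numbers or exceed them by one, and which telescopes against the theta series \<open>\<Theta> = \<Sum>n. \<chi>(n) q\<^bsup>n(n+1)/2\<^esup>\<close>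
(\<open>fine_series_eq_theta\<close>).

Separating partial fractions, the result takes the form
\<open>q\<^sup>3 / (1 - q\<^sup>3) + q (1 + q + \<Theta>) / (1 + q\<^sup>2)\<close> (\<open>b2pp_gf_split\<close>). Here the first summand has
coefficients in \<open>{0, 1}\<close>. A coefficient of \<open>(1 + q + \<Theta>) / (1 + q\<^sup>2)\<close> is \<open>u + v\<close> with \<open>u\<close>, \<open>v\<close>
depending on its index modulo \<open>4\<close>, plus a partial sum of a sequence with entries
\<open>-1, 0, 1\<close>, period \<open>8\<close> and total \<open>0\<close> over a period, so it takes only finitely many values, which
lie in \<open>{-1, 0, 1}\<close> (\<open>theta_walk_bounded\<close>). Adding up gives the range \<open>{-1, 0, 1, 2}\<close>.
\<close>

section \<open>Convergent series of power series\<close>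

text \<open>The sum \<open>\<Sum>i. X\<^bsup>i\<^esup> g\<^sub>i\<close>. The factor \<open>X\<^bsup>i\<^esup>\<close> makes it converge for every \<open>g\<close>, so that linear
operations on it need no summability conditions; all infinite sums below have this form.\<close>

definition xseries :: "(nat \<Rightarrow> 'a::comm_ring_1 fps) \<Rightarrow> 'a fps" where
  "xseries g = Abs_fps (\<lambda>m. \<Sum>i\<le>m. fps_nth (g i) (m - i))"

lemma xseries_shift: "xseries g = g 0 + fps_X * xseries (\<lambda>i. g (Suc i))"
proof (rule fps_ext)
  fix m show "fps_nth (xseries g) m = fps_nth (g 0 + fps_X * xseries (\<lambda>i. g (Suc i))) m"
    by (cases m) (simp_all add: xseries_def sum.atMost_Suc_shift del: sum.atMost_Suc)
qed

lemma xseries_truncate: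
  "xseries g = (\<Sum>i<N. fps_X ^ i * g i) + fps_X ^ N * xseries (\<lambda>i. g (i + N))"
proof (induction N)
  case (Suc N)
  show ?case
    by (subst Suc, subst xseries_shift) (simp add: algebra_simps)
qed simp

lemma fps_eq_0_if_X_power_dvd:
  fixes f :: "'a::comm_ring_1 fps"
  assumes "\<And>N. fps_X ^ N dvd f"
  shows "f = 0"
proof (rule fps_ext)
  fix m
  obtain h where "f = fps_X ^ Suc m * h" using assms[of "Suc m"] by (auto simp: dvd_def)
  thus "fps_nth f m = fps_nth 0 m" by (simp add: fps_X_power_mult_nth del: power_Suc)
qed

text \<open>An expansion to every finite order with some remainder determines the sum; the remainders need
not be related to one another.\<close>

lemma xseries_unique:
  assumes "\<And>N. \<exists>h. f = (\<Sum>i<N. fps_X ^ i * g i) + fps_X ^ N * h"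
  shows "f = xseries g"
proof -
  have "f - xseries g = 0"
  proof (rule fps_eq_0_if_X_power_dvd)
    fix N
    obtain h where h: "f = (\<Sum>i<N. fps_X ^ i * g i) + fps_X ^ N * h" using assms by blast
    show "fps_X ^ N dvd f - xseries g"
      by (subst h, subst xseries_truncate[of g N])
        (simp add: right_diff_distrib[symmetric])
  qed
  thus ?thesis by simp
qed

lemma xseries_diff: "xseries (\<lambda>i. f i - g i) = xseries f - xseries g"
  by (rule fps_ext) (simp add: xseries_def sum_subtractf)

lemma xseries_mult_left: "xseries (\<lambda>i. c * g i) = c * xseries g"
proof (rule xseries_unique[symmetric])
  fix N
  show "\<exists>h. c * xseries g = (\<Sum>i<N. fps_X ^ i * (c * g i)) + fps_X ^ N * h"
    by (rule exI[of _ "c * xseries (\<lambda>i. g (i + N))"], subst xseries_truncate[of g N])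
      (simp add: algebra_simps sum_distrib_left)
qed

lemma xseries_power: "(1 - fps_X * c) * xseries (\<lambda>i. c ^ i) = 1"
  using xseries_shift[of "\<lambda>i. c ^ i"] by (simp add: xseries_mult_left algebra_simps)

lemma xseries_sums: "(\<lambda>i. fps_X ^ i * g i) sums xseries g"
  unfolding sums_def
proof (rule tendsto_fpsI)
  fix m
  show "eventually (\<lambda>N. fps_nth (\<Sum>i<N. fps_X ^ i * g i) m = fps_nth (xseries g) m) sequentially"
  proof (rule eventually_sequentiallyI[of "Suc m"])
    fix N assume "Suc m \<le> N"
    thus "fps_nth (\<Sum>i<N. fps_X ^ i * g i) m = fps_nth (xseries g) m"
      by (subst xseries_truncate[of g N]) (simp add: fps_X_power_mult_nth)
  qed
qed

section \<open>Signed generating functions of multisets of parts\<close>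

definition odd_distinct :: "nat set \<Rightarrow> nat multiset set" where
  "odd_distinct S = {Q. set_mset Q \<subseteq> S \<and> (\<forall>x \<in># Q. odd x \<longrightarrow> count Q x = 1)}"

definition signed_gf :: "nat set \<Rightarrow> rat fps" where
  "signed_gf S = Abs_fps (\<lambda>n. \<Sum>Q | Q \<in> odd_distinct S \<and> sum_mset Q = n. (-1) ^ size Q)"

lemma finite_odd_distinct:
  assumes "0 \<notin> S"
  shows "finite {Q. Q \<in> odd_distinct S \<and> sum_mset Q = n}"
  by (rule finite_subset[OF _ finite_partition_of[of n]])
    (use assms in \<open>auto simp: odd_distinct_def partition_of_def\<close>)

lemma signed_gf_empty: "signed_gf {} = 1"
proof (rule fps_ext)
  fix n
  have "{Q. Q \<in> odd_distinct {} \<and> sum_mset Q = n} = (if n = 0 then {{#}} else {})"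
    by (auto simp: odd_distinct_def)
  thus "fps_nth (signed_gf {}) n = fps_nth 1 n" by (simp add: signed_gf_def)
qed

text \<open>A multiset containing \<open>x\<close> loses one copy of \<open>x\<close>, which flips its sign. The set \<open>T\<close> describes
what can be left over: for even \<open>x\<close> further copies may remain, for odd \<open>x\<close> they may not. These two
cases produce the factors \<open>1 / (1 + X\<^bsup>x\<^esup>)\<close> and \<open>1 - X\<^bsup>x\<^esup>\<close> below.\<close>

lemma signed_gf_insert:
  assumes "0 \<notin> S" "x \<notin> S" "x > 0"
    and T: "\<And>Q. add_mset x Q \<in> odd_distinct (insert x S) \<longleftrightarrow> Q \<in> odd_distinct T"
  shows "signed_gf (insert x S) = signed_gf S - fps_X ^ x * signed_gf T"
proof (rule fps_ext)
  fix n
  let ?A = "{Q. Q \<in> odd_distinct (insert x S) \<and> sum_mset Q = n}"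
  let ?B = "{Q. Q \<in> odd_distinct S \<and> sum_mset Q = n}"
  let ?C = "{Q. Q \<in> odd_distinct (insert x S) \<and> sum_mset Q = n \<and> x \<in># Q}"
  have A: "?A = ?B \<union> ?C" "?B \<inter> ?C = {}"
    using assms(2) by (auto simp: odd_distinct_def)
  have fin: "finite ?A" using assms by (intro finite_odd_distinct) auto
  have "(\<Sum>Q\<in>?C. (-1) ^ size Q :: rat) = - fps_nth (fps_X ^ x * signed_gf T) n"
  proof (cases "x \<le> n")
    case True
    have C: "?C = add_mset x ` {Q. Q \<in> odd_distinct T \<and> sum_mset Q = n - x}"
    proof (intro set_eqI iffI)
      fix Q assume Q: "Q \<in> ?C"
      then obtain Q' where Q': "Q = add_mset x Q'" by (auto dest: multi_member_split)
      with Q T have "Q' \<in> odd_distinct T \<and> sum_mset Q' = n - x" by auto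
      thus "Q \<in> add_mset x ` {Q. Q \<in> odd_distinct T \<and> sum_mset Q = n - x}"
        using Q' by blast
    qed (use True T in auto)
    show ?thesis
      using True unfolding C
      by (subst sum.reindex)
        (auto simp: inj_on_def fps_X_power_mult_nth signed_gf_def sum_negf)
  next
    case False
    hence C: "?C = {}" by (auto dest!: multi_member_split)
    show ?thesis unfolding C using False by (simp add: fps_X_power_mult_nth)
  qed
  moreover have "(\<Sum>Q\<in>?A. (-1) ^ size Q :: rat) =
      (\<Sum>Q\<in>?B. (-1) ^ size Q) + (\<Sum>Q\<in>?C. (-1) ^ size Q)"
    using fin A by (simp add: sum.union_disjoint)
  ultimately show "fps_nth (signed_gf (insert x S)) n =
      fps_nth (signed_gf S - fps_X ^ x * signed_gf T) n"
    by (simp add: signed_gf_def)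
qed

lemma signed_gf_insert_even:
  assumes "0 \<notin> S" "x \<notin> S" "x > 0" "even x"
  shows "(1 + fps_X ^ x) * signed_gf (insert x S) = signed_gf S"
proof -
  have "add_mset x Q \<in> odd_distinct (insert x S) \<longleftrightarrow> Q \<in> odd_distinct (insert x S)" for Q
    using assms(4) unfolding odd_distinct_def by (auto split: if_splits)
  from signed_gf_insert[OF assms(1-3) this] show ?thesis
    by (simp add: algebra_simps)
qed

lemma signed_gf_insert_odd:
  assumes "0 \<notin> S" "x \<notin> S" "odd x"
  shows "signed_gf (insert x S) = (1 - fps_X ^ x) * signed_gf S"
proof -
  have x: "x > 0" using assms(3) by (cases x) auto
  have "add_mset x Q \<in> odd_distinct (insert x S) \<longleftrightarrow> Q \<in> odd_distinct S" for Q
    using assms(2,3) unfolding odd_distinct_def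
    by (auto simp: count_eq_zero_iff split: if_splits)
  from signed_gf_insert[OF assms(1,2) x this] show ?thesis
    by (simp add: algebra_simps)
qed

lemma signed_gf_extend_above:
  assumes "0 < a" "a \<le> 2 * L + 2"
  shows "(1 + fps_X ^ (2 * L + 2)) * signed_gf {a..2 * L + 3} =
    (1 - fps_X ^ (2 * L + 3)) * signed_gf {a..2 * L + 1}"
proof -
  have *: "{a..2 * L + 3} = insert (2 * L + 3) (insert (2 * L + 2) {a..2 * L + 1})"
    using assms by auto
  have "(1 + fps_X ^ (2 * L + 2)) * signed_gf (insert (2 * L + 2) {a..2 * L + 1}) =
      signed_gf {a..2 * L + 1}"
    using assms by (intro signed_gf_insert_even) auto
  moreover have "signed_gf {a..2 * L + 3} =
      (1 - fps_X ^ (2 * L + 3)) * signed_gf (insert (2 * L + 2) {a..2 * L + 1})"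
    using assms unfolding * by (intro signed_gf_insert_odd) auto
  ultimately show ?thesis by (simp add: mult.left_commute)
qed

lemma signed_gf_extend_below:
  assumes "a > 0" "even a" "a < b"
  shows "(1 + fps_X ^ a) * signed_gf {a..b} = (1 - fps_X ^ (a + 1)) * signed_gf {a + 2..b}"
proof -
  have "{a..b} = insert a (insert (a + 1) {a + 2..b})" using assms by auto
  hence "(1 + fps_X ^ a) * signed_gf {a..b} = signed_gf (insert (a + 1) {a + 2..b})"
    using assms signed_gf_insert_even[of "insert (a + 1) {a + 2..b}" a] by simp
  also have "\<dots> = (1 - fps_X ^ (a + 1)) * signed_gf {a + 2..b}"
    using assms by (intro signed_gf_insert_odd) auto
  finally show ?thesis .
qed

lemma one_plus_X_power_neq_0: "m > 0 \<Longrightarrow> (1 + fps_X ^ m :: rat fps) \<noteq> 0"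
  by (auto dest!: arg_cong[of _ _ "\<lambda>f. fps_nth f 0"] simp: fps_X_power_nth)

section \<open>Summation over the smallest even part\<close>

text \<open>The generating function of the parts above \<open>1\<close> when there are \<open>L\<close> ones. The compulsory copy of
\<open>2k\<close> is split off; the weight \<open>(-1)\<^bsup>j+1\<^esup>\<close> for \<open>j\<close> parts is \<open>(-1)\<^bsup>j-1\<^esup>\<close>, the sign of the others.\<close>

definition large_parts_gf :: "nat \<Rightarrow> rat fps" where
  "large_parts_gf L = (\<Sum>k=1..L. fps_X ^ (2 * k) * signed_gf {2 * k..2 * L + 1})"

text \<open>Both new parts \<open>2L+2\<close> and \<open>2L+3\<close> contribute the same factor for every \<open>k\<close>. The additional
inhomogeneity is the new summand \<open>k = L + 1\<close>, whose remaining interval is empty before the step.\<close>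

lemma large_parts_gf_Suc:
  "(1 + fps_X ^ (2 * L + 2)) * large_parts_gf (Suc L) =
    (1 - fps_X ^ (2 * L + 3)) * (large_parts_gf L + fps_X ^ (2 * L + 2))"
proof -
  have "(1 + fps_X ^ (2 * L + 2)) * large_parts_gf (Suc L) =
      (\<Sum>k=1..Suc L. fps_X ^ (2 * k) * ((1 + fps_X ^ (2 * L + 2)) * signed_gf {2 * k..2 * L + 3}))"
    by (simp add: large_parts_gf_def sum_distrib_left algebra_simps numeral_3_eq_3)
  also have "\<dots> = (\<Sum>k=1..Suc L. fps_X ^ (2 * k) *
      ((1 - fps_X ^ (2 * L + 3)) * signed_gf {2 * k..2 * L + 1}))"
    by (intro sum.cong refl arg_cong2[of _ _ _ _ "(*)"] signed_gf_extend_above) auto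
  also have "\<dots> = (1 - fps_X ^ (2 * L + 3)) *
      (large_parts_gf L + fps_X ^ (2 * L + 2) * signed_gf {})"
    by (simp add: large_parts_gf_def sum_distrib_left algebra_simps)
  finally show ?thesis by (simp add: signed_gf_empty)
qed

text \<open>The first term on the right solves the recurrence \<open>large_parts_gf_Suc\<close>; the ansatz
\<open>c + d X\<^bsup>2L\<^esup>\<close> leads to it. The second is the solution of the homogeneous recurrence that makes the
right-hand side vanish at \<open>L = 0\<close>.\<close>

lemma large_parts_gf_closed_form:
  "(1 + fps_X) * large_parts_gf L =
    fps_X * (1 - fps_X ^ (2 * L + 1)) - fps_X * (1 - fps_X) * signed_gf {2..2 * L + 1}"
proof (induction L)
  case 0
  show ?case by (simp add: large_parts_gf_def signed_gf_empty)
next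
  case (Suc L)
  let ?u = "1 + fps_X ^ (2 * L + 2) :: rat fps"
  let ?v = "1 - fps_X ^ (2 * L + 3) :: rat fps"
  define y where "y = (fps_X ^ (2 * L) :: rat fps)"
  have "?u * ((1 + fps_X) * large_parts_gf (Suc L)) =
      (1 + fps_X) * (?u * large_parts_gf (Suc L))" by (simp only: mult.left_commute)
  also have "\<dots> = ?v * ((1 + fps_X) * large_parts_gf L + (1 + fps_X) * fps_X ^ (2 * L + 2))"
    unfolding large_parts_gf_Suc by (simp only: distrib_left mult.left_commute)
  also have "\<dots> = ?v * (fps_X * (1 - fps_X ^ (2 * L + 1)) + (1 + fps_X) * fps_X ^ (2 * L + 2)) -
      fps_X * (1 - fps_X) * (?v * signed_gf {2..2 * L + 1})"
    unfolding Suc.IH by (simp only: distrib_left right_diff_distrib mult.left_commute) simp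
  also have "?v * signed_gf {2..2 * L + 1} = ?u * signed_gf {2..2 * L + 3}"
    by (rule signed_gf_extend_above[symmetric]) auto
  also have "?v * (fps_X * (1 - fps_X ^ (2 * L + 1)) + (1 + fps_X) * fps_X ^ (2 * L + 2)) =
      ?u * (fps_X * (1 - fps_X ^ (2 * L + 3)))"
    by (simp add: power_add y_def[symmetric] algebra_simps power2_eq_square power3_eq_cube)
  finally have "?u * ((1 + fps_X) * large_parts_gf (Suc L)) = ?u * (fps_X * (1 - fps_X ^ (2 * L + 3))
      - fps_X * (1 - fps_X) * signed_gf {2..2 * L + 3})"
    by (simp only: right_diff_distrib mult.left_commute)
  hence "(1 + fps_X) * large_parts_gf (Suc L) = fps_X * (1 - fps_X ^ (2 * L + 3))
      - fps_X * (1 - fps_X) * signed_gf {2..2 * L + 3}"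
    using one_plus_X_power_neq_0[of "2 * L + 2"] by simp
  moreover have "2 * Suc L + 1 = 2 * L + 3" by simp
  ultimately show ?case by metis
qed

section \<open>Fine's iteration\<close>

text \<open>Up to its two normalising factors this is the basic hypergeometric series
\<open>\<Sum>L. (q\<^bsup>2n+3\<^esup>;q\<^sup>2)\<^sub>L / (-q\<^bsup>2n+2\<^esup>;q\<^sup>2)\<^sub>L q\<^bsup>(2n+1)L\<^esup>\<close>, one power \<open>q\<^bsup>L\<^esup>\<close> being supplied by \<open>xseries\<close>.
Passing from \<open>n\<close> to \<open>n + 1\<close> multiplies both parameters and the argument by the base \<open>q\<^sup>2\<close>. The
normalisation clears the denominators of Fine's functional equation.\<close>

definition fine_series :: "nat \<Rightarrow> rat fps" where
  "fine_series n = (1 - fps_X ^ (2 * n + 1)) * (1 + fps_X ^ (2 * n + 2)) *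
     xseries (\<lambda>L. (fps_X ^ (2 * n)) ^ L * signed_gf {2 * n + 2..2 * n + 2 * L + 1})"

text \<open>With \<open>x = X\<^bsup>2n\<^esup>\<close> and \<open>p\<^sub>L\<close> the product in the summand, multiplying \<open>\<Sum>L. (xX)\<^bsup>L\<^esup> p\<^sub>L\<close> by \<open>1 - xX\<close>
produces the differences \<open>p\<^sub>L\<^sub>+\<^sub>1 - p\<^sub>L\<close>. By the two-term recurrence of \<open>p\<close> these carry a factor
\<open>x X\<^bsup>2L+2\<^esup>\<close>, which shifts the argument from \<open>xX\<close> to \<open>xX\<^sup>3\<close>, the argument of the next series.\<close>

lemma fine_series_rec:
  "fine_series n = (1 - fps_X ^ (4 * n + 4)) * (1 + fps_X ^ (2 * n + 2)) - fps_X ^ (4 * n + 3) * fine_series (Suc n)"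
proof -
  define X where "X = (fps_X :: rat fps)"
  define x where "x = X ^ (2 * n)"
  define p where "p L = signed_gf {2 * n + 2..2 * n + 2 * L + 1}" for L
  define A where "A = xseries (\<lambda>L. x ^ L * p L)"
  define A' where "A' = xseries (\<lambda>L. x ^ L * p (Suc L))"
  define B where "B = xseries (\<lambda>L. (x * X ^ 2) ^ L * p L)"
  define C where "C = xseries (\<lambda>L. (x * X ^ 2) ^ L * p (Suc L))"
  have p0: "p 0 = 1" by (simp add: p_def signed_gf_empty)
  have A: "A = 1 + X * x * A'"
    unfolding A_def by (subst xseries_shift)
      (simp add: p0 A'_def xseries_mult_left mult.assoc X_def)
  have B: "B = 1 + x * X ^ 3 * C"
    unfolding B_def by (subst xseries_shift)
      (simp add: p0 C_def xseries_mult_left mult.assoc X_def power3_eq_cube power2_eq_square mult_ac)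
  have rec: "(1 + x * X ^ 2 * (X ^ 2) ^ L) * p (Suc L) = (1 - x * X ^ 3 * (X ^ 2) ^ L) * p L" for L
  proof -
    have "x * X ^ 2 * (X ^ 2) ^ L = X ^ (2 * (n + L) + 2)"
      "x * X ^ 3 * (X ^ 2) ^ L = X ^ (2 * (n + L) + 3)"
      unfolding x_def power_mult[symmetric] power_add[symmetric]
      by (rule arg_cong[of _ _ "\<lambda>i. X ^ i"], simp)+
    thus ?thesis
      using signed_gf_extend_above[of "2 * n + 2" "n + L"]
      by (simp add: p_def X_def numeral_3_eq_3)
  qed
  have "x ^ L * p (Suc L) - x ^ L * p L =
      (- x * X ^ 2) * ((x * X ^ 2) ^ L * p (Suc L)) - x * X ^ 3 * ((x * X ^ 2) ^ L * p L)" for L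
    using arg_cong[OF rec[of L], of "\<lambda>z. x ^ L * z"]
    by (simp add: algebra_simps power_mult_distrib)
  hence "A' - A = (- x * X ^ 2) * C - x * X ^ 3 * B"
    unfolding A'_def A_def B_def C_def by (simp only: xseries_diff[symmetric] xseries_mult_left[symmetric])
  moreover have "(1 - X * x) * A = 1 + X * x * (A' - A)"
    using A by (simp add: algebra_simps)
  ultimately have "(1 - X * x) * A = 1 + X * x * ((- x * X ^ 2) * C - x * X ^ 3 * B)"
    by (simp only:)
  also have "\<dots> = 1 - x ^ 2 * X ^ 4 - x ^ 2 * X ^ 3 * (1 + x * X ^ 4) * C"
    unfolding B by (simp add: algebra_simps eval_nat_numeral)
  finally have key: "(1 - X * x) * A = 1 - x ^ 2 * X ^ 4 - x ^ 2 * X ^ 3 * (1 + x * X ^ 4) * C" .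
  \<comment> \<open>Lower parameters of the next series, expressed by the products of the present one.\<close>
  have low: "(1 - x * X ^ 3) * signed_gf {2 * Suc n + 2..2 * Suc n + 2 * L + 1} =
      (1 + x * X ^ 2) * p (Suc L)" for L
  proof -
    have "x * X ^ 2 = X ^ (2 * n + 2)" "x * X ^ 3 = X ^ (2 * n + 2 + 1)"
      by (simp_all add: x_def power_add eval_nat_numeral)
    moreover have "{2 * n + 2 + 2..2 * n + 2 * L + 3} = {2 * Suc n + 2..2 * Suc n + 2 * L + 1}"
      "{2 * n + 2..2 * n + 2 * L + 3} = {2 * n + 2..2 * n + 2 * Suc L + 1}" by auto
    ultimately show ?thesis
      using signed_gf_extend_below[of "2 * n + 2" "2 * n + 2 * L + 3"]
      by (simp only: p_def X_def) simp
  qed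
  have "fine_series (Suc n) = (1 + x * X ^ 4) * xseries (\<lambda>L. (1 - x * X ^ 3) *
      ((x * X ^ 2) ^ L * signed_gf {2 * Suc n + 2..2 * Suc n + 2 * L + 1}))"
    unfolding fine_series_def xseries_mult_left
    by (simp add: x_def X_def power_add eval_nat_numeral mult_ac)
  also have "\<dots> = (1 + x * X ^ 4) * xseries (\<lambda>L. (1 + x * X ^ 2) * ((x * X ^ 2) ^ L * p (Suc L)))"
    using low by (simp only: mult.left_commute[of "1 - x * X ^ 3"] mult.left_commute[of "1 + x * X ^ 2"])
  also have "\<dots> = (1 + x * X ^ 4) * (1 + x * X ^ 2) * C"
    unfolding xseries_mult_left C_def by (simp only: mult.assoc)
  finally have S: "fine_series (Suc n) = (1 + x * X ^ 4) * (1 + x * X ^ 2) * C" .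
  have xx: "X ^ (4 * n) = x ^ 2" by (simp add: x_def power_mult[symmetric] mult.commute)
  have "fine_series n = (1 + x * X ^ 2) * ((1 - X * x) * A)"
    by (simp add: fine_series_def A_def p_def x_def X_def power_add power2_eq_square mult_ac)
  also have "\<dots> = (1 - x ^ 2 * X ^ 4) * (1 + x * X ^ 2) - x ^ 2 * X ^ 3 * fine_series (Suc n)"
    unfolding key S by (simp add: algebra_simps)
  finally show ?thesis
    by (simp only: power_add xx x_def X_def[symmetric])
qed

lemma fine_series_iterate:
  "fine_series 0 = (\<Sum>n<N. (-1) ^ n * fps_X ^ (2 * n\<^sup>2 + n) *
      ((1 - fps_X ^ (4 * n + 4)) * (1 + fps_X ^ (2 * n + 2))))
    + (-1) ^ N * fps_X ^ (2 * N\<^sup>2 + N) * fine_series N"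
proof (induction N)
  case (Suc N)
  have e: "2 * (Suc N)\<^sup>2 + Suc N = 2 * N\<^sup>2 + N + (4 * N + 3)"
    by (simp add: power2_eq_square)
  have p: "fps_X ^ (2 * (Suc N)\<^sup>2 + Suc N) = (fps_X ^ (2 * N\<^sup>2 + N) * fps_X ^ (4 * N + 3) :: rat fps)"
    unfolding e by (rule power_add)
  note Suc.IH
  also have "fine_series N = (1 - fps_X ^ (4 * N + 4)) * (1 + fps_X ^ (2 * N + 2)) -
      fps_X ^ (4 * N + 3) * fine_series (Suc N)" by (rule fine_series_rec)
  finally show ?case unfolding p by (simp add: algebra_simps)
qed simp

section \<open>Comparison with the theta series\<close>

lemma triangle_even: "Suc (2 * n) choose 2 = 2 * n\<^sup>2 + n"
  by (induction n) (simp_all add: eval_nat_numeral)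

lemma triangle_odd: "Suc (Suc (2 * n)) choose 2 = 2 * n\<^sup>2 + 3 * n + 1"
  by (induction n) (simp_all add: eval_nat_numeral)

definition theta :: "rat fps" where
  "theta = (\<Sum>n. of_int (chi n) * fps_X ^ (Suc n choose 2))"

text \<open>The \<open>n\<close>-th triangular number is \<open>n + (n choose 2)\<close>, which brings the theta series into the form
\<open>\<Sum>n. X\<^bsup>n\<^esup> g\<^sub>n\<close>.\<close>

lemma theta_term: "(of_int (chi n) * fps_X ^ (Suc n choose 2) :: rat fps) =
    fps_X ^ n * (of_int (chi n) * fps_X ^ (n choose 2))"
proof -
  have "Suc n choose 2 = n + (n choose 2)" by (simp add: numeral_2_eq_2)
  thus ?thesis by (simp add: power_add mult_ac)
qed

lemma theta_xseries: "theta = xseries (\<lambda>n. of_int (chi n) * fps_X ^ (n choose 2))"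
  unfolding theta_def theta_term by (rule sums_unique[symmetric, OF xseries_sums])

lemma chi_even: "chi (2 * n) = - ((-1) ^ n)" and chi_odd: "chi (Suc (2 * n)) = - ((-1) ^ n)"
proof -
  have "chi (2 * n) = - ((-1) ^ n) \<and> chi (Suc (2 * n)) = - ((-1) ^ n)"
  proof (cases "even n")
    case True
    then obtain m where "n = 2 * m" ..
    hence "2 * n mod 4 = 0" "Suc (2 * n) mod 4 = 1" by presburger+
    thus ?thesis using True by (simp add: chi_def)
  next
    case False
    then obtain m where "n = 2 * m + 1" by (rule oddE)
    hence "2 * n mod 4 = 2" "Suc (2 * n) mod 4 = 3" by presburger+
    thus ?thesis using False by (simp add: chi_def)
  qed
  thus "chi (2 * n) = - ((-1) ^ n)" "chi (Suc (2 * n)) = - ((-1) ^ n)" by auto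
qed

text \<open>Put \<open>u\<^sub>n = (-1)\<^bsup>n\<^esup> (X\<^bsup>t+1\<^esup> + X\<^bsup>t'\<^esup>)\<close>, where \<open>t\<close> and \<open>t'\<close> are the triangular numbers with
indices \<open>2n\<close> and \<open>2n+1\<close>. The \<open>n\<close>-th term of the iterated series together with \<open>1 + X\<close> times the two matching
theta terms is \<open>u\<^sub>n\<^sub>+\<^sub>1 - u\<^sub>n\<close>, and \<open>u\<^sub>0 = 2X\<close>.\<close>

lemma fine_series_theta_telescope:
  "(\<Sum>n<N. (-1) ^ n * fps_X ^ (2 * n\<^sup>2 + n) * ((1 - fps_X ^ (4 * n + 4)) * (1 + fps_X ^ (2 * n + 2))))
    + (1 + fps_X) * (\<Sum>n<2 * N. of_int (chi n) * fps_X ^ (Suc n choose 2)) + 2 * fps_X =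
    (-1) ^ N * (fps_X ^ (2 * N\<^sup>2 + N + 1) + fps_X ^ (2 * N\<^sup>2 + 3 * N + 1) :: rat fps)"
  (is "?lhs N = ?rhs N")
proof (induction N)
  case (Suc N)
  have e: "2 * (Suc N)\<^sup>2 + Suc N + 1 = 2 * N\<^sup>2 + 5 * N + 4"
    "2 * (Suc N)\<^sup>2 + 3 * Suc N + 1 = 2 * N\<^sup>2 + 7 * N + 6"
    by (simp_all add: power2_eq_square)
  define y where "y = (fps_X ^ N :: rat fps)"
  define z where "z = (fps_X ^ (2 * N\<^sup>2) :: rat fps)"
  define s where "s = ((-1) ^ N :: rat fps)"
  have s: "(\<Sum>n<2 * Suc N. of_int (chi n) * fps_X ^ (Suc n choose 2) :: rat fps) =
     (\<Sum>n<2 * N. of_int (chi n) * fps_X ^ (Suc n choose 2))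
     - s * fps_X ^ (2 * N\<^sup>2 + N) - s * fps_X ^ (2 * N\<^sup>2 + 3 * N + 1)"
    unfolding s_def using triangle_even[of N] triangle_odd[of N]
    by (simp add: chi_even chi_odd)
  let ?R = "s * fps_X ^ (2 * N\<^sup>2 + N) * ((1 - fps_X ^ (4 * N + 4)) * (1 + fps_X ^ (2 * N + 2)))"
  have "?R - (1 + fps_X) * (s * fps_X ^ (2 * N\<^sup>2 + N) + s * fps_X ^ (2 * N\<^sup>2 + 3 * N + 1))
     + s * (fps_X ^ (2 * N\<^sup>2 + N + 1) + fps_X ^ (2 * N\<^sup>2 + 3 * N + 1)) =
     - s * (fps_X ^ (2 * N\<^sup>2 + 5 * N + 4) + fps_X ^ (2 * N\<^sup>2 + 7 * N + 6))"
  proof -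
    have p: "fps_X ^ (m * N) = y ^ m" for m
      by (simp add: y_def power_mult[symmetric] mult.commute)
    show ?thesis
      by (simp only: power_add z_def[symmetric] y_def[symmetric] p)
        (simp add: algebra_simps eval_nat_numeral)
  qed
  hence R: "?R = (1 + fps_X) * (s * fps_X ^ (2 * N\<^sup>2 + N) + s * fps_X ^ (2 * N\<^sup>2 + 3 * N + 1))
     - s * (fps_X ^ (2 * N\<^sup>2 + N + 1) + fps_X ^ (2 * N\<^sup>2 + 3 * N + 1))
     - s * (fps_X ^ (2 * N\<^sup>2 + 5 * N + 4) + fps_X ^ (2 * N\<^sup>2 + 7 * N + 6))"
    by (simp add: algebra_simps)
  have "?lhs (Suc N) = ?lhs N + ?R - (1 + fps_X) *
      (s * fps_X ^ (2 * N\<^sup>2 + N) + s * fps_X ^ (2 * N\<^sup>2 + 3 * N + 1))"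
    unfolding s sum.lessThan_Suc s_def[symmetric]
    by (simp only: right_diff_distrib distrib_left diff_conv_add_uminus minus_add_distrib
        mult_minus_right add_ac)
  also have "\<dots> = ?rhs (Suc N)"
    unfolding Suc.IH R e by (simp add: s_def)
  finally show ?case .
qed simp

text \<open>After \<open>N\<close> steps of the iteration and \<open>2N\<close> theta terms everything left over is divisible by
\<open>X\<^bsup>N\<^esup>\<close>.\<close>

lemma fine_series_eq_theta: "fine_series 0 = - (1 + fps_X) * theta - 2 * fps_X"
proof -
  have "fine_series 0 + (1 + fps_X) * theta + 2 * fps_X = 0"
  proof (rule fps_eq_0_if_X_power_dvd)
    fix N
    define h where "h = xseries (\<lambda>i. of_int (chi (i + 2 * N)) * fps_X ^ (i + 2 * N choose 2) :: rat fps)"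
    have theta: "theta = (\<Sum>n<2 * N. of_int (chi n) * fps_X ^ (Suc n choose 2)) + fps_X ^ (2 * N) * h"
      unfolding theta_term h_def theta_xseries by (rule xseries_truncate)
    have th: "(1 + fps_X) * theta = (1 + fps_X) *
        (\<Sum>n<2 * N. of_int (chi n) * fps_X ^ (Suc n choose 2)) + (1 + fps_X) * (fps_X ^ (2 * N) * h)"
      by (subst theta) (rule distrib_left)
    have "fine_series 0 + (1 + fps_X) * theta + 2 * fps_X =
        (-1) ^ N * (fps_X ^ (2 * N\<^sup>2 + N + 1) + fps_X ^ (2 * N\<^sup>2 + 3 * N + 1)) +
        (1 + fps_X) * (fps_X ^ (2 * N) * h) + (-1) ^ N * fps_X ^ (2 * N\<^sup>2 + N) * fine_series N"
      unfolding fine_series_theta_telescope[symmetric]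
      by (subst fine_series_iterate[of N], subst th) (simp only: add_ac)
    also have "fps_X ^ N dvd \<dots>"
      by (intro dvd_add dvd_mult dvd_mult2 le_imp_power_dvd) auto
    finally show "fps_X ^ N dvd fine_series 0 + (1 + fps_X) * theta + 2 * fps_X" .
  qed
  thus ?thesis by (simp add: algebra_simps eq_neg_iff_add_eq_0)
qed

section \<open>The generating function of the signed partition count\<close>

text \<open>An admissible partition is determined by its number \<open>L\<close> of ones, half of its smallest even
part, \<open>k\<close>, and the multiset \<open>Q\<close> of its parts above \<open>1\<close> with one copy of \<open>2k\<close> removed; conversely
every \<open>Q\<close> with parts in \<open>{2k..2L+1}\<close> and distinct odd parts occurs when \<open>1 \<le> k \<le> L\<close>.\<close>

lemma b2pp_gf: "Abs_fps (\<lambda>n. of_int (b2pp n)) = xseries large_parts_gf"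
proof (rule fps_ext)
  fix n
  define A where "A L k = {Q. Q \<in> odd_distinct {2 * k..2 * L + 1} \<and> L + 2 * k + sum_mset Q = n}" for L k
  define D where "D = (SIGMA L:{..n}. SIGMA k:{1..L}. A L k)"
  define h :: "nat \<times> nat \<times> nat multiset \<Rightarrow> nat multiset"
    where "h = (\<lambda>(L, k, Q). replicate_mset L 1 + add_mset (2 * k) Q)"
  have AD: "x \<ge> 2 * k" "x \<le> 2 * L + 1" if "Q \<in> A L k" "x \<in># Q" for Q L k x
    using that by (auto simp: A_def odd_distinct_def)
  have one: "1 \<notin># add_mset (2 * k) Q" if "Q \<in> A L k" "k \<ge> 1" for Q L k
    using AD(1)[OF that(1), of 1] that(2) by auto
  have finA: "finite (A L k)" if "k \<ge> 1" for L k
    by (rule finite_subset[OF _ finite_odd_distinct[of "{2 * k..2 * L + 1}" "n - L - 2 * k"]])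
      (use that in \<open>auto simp: A_def\<close>)
  have inj: "inj_on h D"
  proof (rule inj_onI)
    fix d d' assume D: "d \<in> D" "d' \<in> D" "h d = h d'"
    obtain L k Q L' k' Q' where d: "d = (L, k, Q)" "d' = (L', k', Q')"
      using prod_cases3 by metis
    from D have eq: "h (L, k, Q) = h (L', k', Q')" by (simp add: d)
    from D have Q: "Q \<in> A L k" "k \<ge> 1" "Q' \<in> A L' k'" "k' \<ge> 1" by (auto simp: D_def d)
    have "count (h (L, k, Q)) 1 = L" "count (h (L', k', Q')) 1 = L'"
      using one[OF Q(1,2)] one[OF Q(3,4)] by (auto simp: h_def count_eq_zero_iff)
    with eq have L: "L = L'" by simp
    with eq have eq': "add_mset (2 * k) Q = add_mset (2 * k') Q'" by (simp add: h_def)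
    have "2 * k \<in># add_mset (2 * k') Q'" "2 * k' \<in># add_mset (2 * k) Q"
      using eq' union_single_eq_member by metis+
    with AD(1)[OF Q(1), of "2 * k'"] AD(1)[OF Q(3), of "2 * k"] have "k = k'" by auto
    with L eq' show "d = d'" by (simp add: d)
  qed
  have img: "h ` D = b2pp_partitions n"
  proof (intro set_eqI iffI)
    fix P assume "P \<in> h ` D"
    then obtain L k Q where LkQ: "L \<le> n" "1 \<le> k" "k \<le> L" "Q \<in> A L k" "P = h (L, k, Q)"
      by (auto simp: D_def)
    have P: "P = replicate_mset L 1 + add_mset (2 * k) Q" using LkQ by (simp add: h_def)
    have Q: "Q \<in> odd_distinct {2 * k..2 * L + 1}" "L + 2 * k + sum_mset Q = n"
      using LkQ by (auto simp: A_def)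
    have "b2pp_admissible (L + 1) k P"
      using LkQ(1-3) Q(1) one[OF LkQ(4,2)] unfolding b2pp_admissible_def P odd_distinct_def
      by (auto simp: count_eq_zero_iff split: if_splits)
    moreover have "partition_of n P"
      using LkQ(1-3) Q unfolding partition_of_def P odd_distinct_def by auto
    ultimately show "P \<in> b2pp_partitions n" by (auto simp: b2pp_partitions_def)
  next
    fix P assume "P \<in> b2pp_partitions n"
    then obtain l k where P: "partition_of n P" "b2pp_admissible l k P"
      by (auto simp: b2pp_partitions_def)
    define Q where "Q = filter_mset (\<lambda>x. x > 1) P - {#2 * k#}"
    have k: "1 \<le> k" "k \<le> l - 1" "count P 1 = l - 1" "2 * k \<in># P" "0 \<notin># P"
      using P by (auto simp: b2pp_admissible_def partition_of_def)
    have "2 * k \<in># filter_mset (\<lambda>x. x > 1) P" using k by auto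
    hence F: "filter_mset (\<lambda>x. x > 1) P = add_mset (2 * k) Q" by (simp add: Q_def)
    have "P = replicate_mset (l - 1) 1 + filter_mset (\<lambda>x. x > 1) P"
    proof (rule multiset_eqI)
      fix x :: nat
      have "x = 0 \<or> x = 1 \<or> x > 1" by auto
      thus "count P x = count (replicate_mset (l - 1) 1 + filter_mset (\<lambda>x. x > 1) P) x"
        using k by (auto simp: count_eq_zero_iff)
    qed
    hence P': "P = h (l - 1, k, Q)" unfolding F by (simp add: h_def)
    have "sum_mset P = n" using P by (simp add: partition_of_def)
    hence sum: "l - 1 + 2 * k + sum_mset Q = n" unfolding P' by (simp add: h_def)
    have Qs: "x \<in># P" "x > 1" if "x \<in># Q" for x
      using that F by (metis mem_Collect_eq set_mset_filter union_iff add_mset_add_single)+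
    have "count Q x = 1" if "x \<in># Q" "odd x" for x
    proof -
      have "count P x = 1"
        using that Qs[OF that(1)] P(2) by (auto simp: b2pp_admissible_def)
      moreover have "count Q x \<le> count P x"
        by (simp add: Q_def)
      moreover have "count Q x > 0" using that(1) by simp
      ultimately show ?thesis by linarith
    qed
    moreover have "x \<in> {2 * k..2 * (l - 1) + 1}" if "x \<in># Q" for x
    proof -
      have "x \<in> {2 * k..2 * l - 1}"
        using that Qs[OF that] P(2) by (auto simp: b2pp_admissible_def)
      thus ?thesis using k by auto
    qed
    ultimately have "Q \<in> A (l - 1) k" using sum by (auto simp: A_def odd_distinct_def)
    hence "(l - 1, k, Q) \<in> D" using k sum by (auto simp: D_def)
    thus "P \<in> h ` D" using P' by blast
  qed
  \<comment> \<open>The removed part \<open>2k\<close> and the shift in the exponent change the sign twice.\<close>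
  have wt: "size {#x \<in># h (L, k, Q). x > 1#} + 1 = size Q + 2" if "(L, k, Q) \<in> D" for L k Q
  proof -
    have Q: "Q \<in> A L k" "k \<ge> 1" using that by (auto simp: D_def)
    have "{#x \<in># Q. x > 1#} = Q"
      using AD(1)[OF Q(1)] Q(2) by (force simp: filter_mset_eq_conv)
    moreover have "{#x \<in># replicate_mset L 1. x > 1#} = ({#} :: nat multiset)"
      by (auto simp: filter_mset_eq_conv)
    ultimately show ?thesis using Q(2) by (simp add: h_def)
  qed
  have "of_int (b2pp n) = (\<Sum>P \<in> h ` D. (-1) ^ (size {#x \<in># P. x > 1#} + 1) :: rat)"
    by (simp add: b2pp_def img)
  also have "\<dots> = (\<Sum>d\<in>D. (-1) ^ (size {#x \<in># h d. x > 1#} + 1))"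
    by (subst sum.reindex[OF inj]) simp
  also have "\<dots> = (\<Sum>(L, k, Q)\<in>D. (-1) ^ size Q)"
    by (rule sum.cong[OF refl]) (clarify, simp only: wt, simp)
  also have "\<dots> = (\<Sum>L\<le>n. \<Sum>k=1..L. \<Sum>Q\<in>A L k. (-1) ^ size Q)"
    unfolding D_def using finA
    by (subst sum.Sigma[symmetric]) (auto simp: sum.Sigma)
  also have "\<dots> = (\<Sum>L\<le>n. \<Sum>k=1..L. fps_nth (fps_X ^ (2 * k) * signed_gf {2 * k..2 * L + 1}) (n - L))"
  proof (intro sum.cong refl)
    fix L k assume "L \<in> {..n}" "k \<in> {1..L}"
    hence "A L k = (if 2 * k \<le> n - L
        then {Q. Q \<in> odd_distinct {2 * k..2 * L + 1} \<and> sum_mset Q = n - L - 2 * k} else {})"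
      by (auto simp: A_def)
    thus "(\<Sum>Q\<in>A L k. (-1) ^ size Q) =
        fps_nth (fps_X ^ (2 * k) * signed_gf {2 * k..2 * L + 1}) (n - L)"
      by (simp add: fps_X_power_mult_nth signed_gf_def)
  qed
  also have "\<dots> = fps_nth (xseries large_parts_gf) n"
    by (simp add: xseries_def large_parts_gf_def fps_sum_nth)
  finally show "fps_nth (Abs_fps (\<lambda>n. of_int (b2pp n))) n = fps_nth (xseries large_parts_gf) n"
    by simp
qed

lemma b2pp_gf_equation:
  "(1 - fps_X ^ 3) * (1 + fps_X ^ 2) * Abs_fps (\<lambda>n. of_int (b2pp n)) =
    fps_X ^ 3 * (1 + fps_X ^ 2) + fps_X * (1 - fps_X ^ 3) * (1 + fps_X + theta)"
proof -
  define X where "X = (fps_X :: rat fps)"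
  define S where "S = xseries large_parts_gf"
  define E where "E = xseries (\<lambda>L. 1 ^ L :: rat fps)"
  define E' where "E' = xseries (\<lambda>L. (X ^ 2) ^ L)"
  define G where "G = xseries (\<lambda>L. signed_gf {2..2 * L + 1})"
  have "(1 + X) * S = xseries (\<lambda>L. X * 1 ^ L - X ^ 2 * (X ^ 2) ^ L -
      X * (1 - X) * signed_gf {2..2 * L + 1})"
    unfolding S_def xseries_mult_left[symmetric] X_def large_parts_gf_closed_form
    by (simp add: algebra_simps power_mult power2_eq_square)
  hence S: "(1 + X) * S = X * E - X ^ 2 * E' - X * (1 - X) * G"
    by (simp only: xseries_diff xseries_mult_left E_def E'_def G_def)
  have E: "(1 - X) * E = 1" using xseries_power[of "1 :: rat fps"] by (simp add: E_def X_def)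
  have E': "(1 - X ^ 3) * E' = 1"
    using xseries_power[of "X ^ 2"] by (simp add: E'_def X_def eval_nat_numeral)
  have G: "(1 - X) * (1 + X ^ 2) * G = - (1 + X) * theta - 2 * X"
    using fine_series_eq_theta by (simp add: fine_series_def G_def X_def numeral_2_eq_2)
  have cube: "1 - X ^ 3 = (1 + X + X ^ 2) * (1 - X)"
    by (simp add: algebra_simps eval_nat_numeral)
  have "(1 + X) * ((1 - X ^ 3) * (1 + X ^ 2) * S) = (1 - X ^ 3) * (1 + X ^ 2) * ((1 + X) * S)"
    by (simp only: mult_ac)
  also have "\<dots> = X * (1 + X ^ 2) * ((1 - X ^ 3) * E) - X ^ 2 * (1 + X ^ 2) * ((1 - X ^ 3) * E')
      - X * (1 - X ^ 3) * ((1 - X) * (1 + X ^ 2) * G)"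
  proof -
    have "P * W * (X * E - X ^ 2 * E' - X * (1 - X) * G) =
        X * W * (P * E) - X ^ 2 * W * (P * E') - X * P * ((1 - X) * W * G)" for P W
      by (simp add: algebra_simps)
    thus ?thesis unfolding S .
  qed
  also have "(1 - X ^ 3) * E = 1 + X + X ^ 2"
    unfolding cube mult.assoc E by simp
  also have "X * (1 + X ^ 2) * (1 + X + X ^ 2) - X ^ 2 * (1 + X ^ 2) * ((1 - X ^ 3) * E')
      - X * (1 - X ^ 3) * ((1 - X) * (1 + X ^ 2) * G) =
      (1 + X) * (X ^ 3 * (1 + X ^ 2) + X * (1 - X ^ 3) * (1 + X + theta))"
    unfolding E' G by (simp add: algebra_simps eval_nat_numeral)
  finally have "(1 - X ^ 3) * (1 + X ^ 2) * S = X ^ 3 * (1 + X ^ 2) + X * (1 - X ^ 3) * (1 + X + theta)"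
    using one_plus_X_power_neq_0[of 1] by (simp add: X_def)
  thus ?thesis by (simp only: X_def S_def b2pp_gf)
qed

section \<open>Bounds on the coefficients\<close>

text \<open>The real part of \<open>i\<^bsup>s\<^esup>\<close>, that is, the coefficient of \<open>X\<^bsup>s\<^esup>\<close> in \<open>1 / (1 + X\<^sup>2)\<close> for \<open>s \<ge> 0\<close>. Integer
arguments make it periodic without exceptions near \<open>0\<close>.\<close>

definition re_i_power :: "int \<Rightarrow> int" where
  "re_i_power s = (if s mod 4 = 0 then 1 else if s mod 4 = 2 then -1 else 0)"

lemma re_i_power_cong: "s mod 4 = t mod 4 \<Longrightarrow> re_i_power s = re_i_power t"
  by (simp add: re_i_power_def)

lemma re_i_power_minus_2: "re_i_power (s - 2) = - re_i_power s"
  by (auto simp: re_i_power_def; presburger)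

definition inv_one_plus_X2 :: "rat fps" where
  "inv_one_plus_X2 = Abs_fps (\<lambda>m. of_int (re_i_power (int m)))"

definition inv_one_minus_X3 :: "rat fps" where
  "inv_one_minus_X3 = Abs_fps (\<lambda>m. of_bool (3 dvd m))"

lemma inv_one_plus_X2: "(1 + fps_X ^ 2) * inv_one_plus_X2 = 1"
proof (rule fps_ext)
  fix m
  have *: "(1 + fps_X ^ 2) * inv_one_plus_X2 = inv_one_plus_X2 + fps_X ^ 2 * inv_one_plus_X2"
    by (simp add: algebra_simps)
  have "m \<ge> 2 \<Longrightarrow> of_int (re_i_power (int m)) + of_int (re_i_power (int (m - 2))) = (0 :: rat)"
    by (simp add: of_nat_diff re_i_power_minus_2)
  moreover have "m = 0 \<or> m = 1 \<or> m \<ge> 2" by auto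
  ultimately show "fps_nth ((1 + fps_X ^ 2) * inv_one_plus_X2) m = fps_nth 1 m"
    unfolding * fps_add_nth fps_X_power_mult_nth
    by (elim disjE) (simp_all add: inv_one_plus_X2_def re_i_power_def[of 0] re_i_power_def[of 1])
qed

lemma inv_one_minus_X3: "(1 - fps_X ^ 3) * inv_one_minus_X3 = 1"
proof (rule fps_ext)
  fix m :: nat
  have *: "(1 - fps_X ^ 3) * inv_one_minus_X3 = inv_one_minus_X3 - fps_X ^ 3 * inv_one_minus_X3"
    by (simp add: algebra_simps)
  have "m < 3 \<longrightarrow> (3 dvd m \<longleftrightarrow> m = 0)" "m \<ge> 3 \<longrightarrow> (3 dvd m - 3 \<longleftrightarrow> 3 dvd m)" by presburger+
  thus "fps_nth ((1 - fps_X ^ 3) * inv_one_minus_X3) m = fps_nth 1 m"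
    unfolding * fps_sub_nth fps_X_power_mult_nth
    by (auto simp: inv_one_minus_X3_def)
qed

text \<open>This partial fraction form is the one with visibly small coefficients: \<open>1 + X\<close> cancels the first
two terms of the theta series, which would shift the second summand away from \<open>{-1, 0, 1}\<close>.\<close>

lemma b2pp_gf_split:
  "Abs_fps (\<lambda>n. of_int (b2pp n)) =
    fps_X * (fps_X ^ 2 * inv_one_minus_X3 + (1 + fps_X + theta) * inv_one_plus_X2)"
proof -
  let ?S = "Abs_fps (\<lambda>n. of_int (b2pp n)) :: rat fps"
  have "?S = ((1 - fps_X ^ 3) * inv_one_minus_X3) * ((1 + fps_X ^ 2) * inv_one_plus_X2) * ?S"
    by (simp add: inv_one_plus_X2 inv_one_minus_X3)
  also have "\<dots> = inv_one_minus_X3 * inv_one_plus_X2 * ((1 - fps_X ^ 3) * (1 + fps_X ^ 2) * ?S)"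
    by (simp only: mult_ac)
  also have "\<dots> = fps_X ^ 3 * inv_one_minus_X3 * ((1 + fps_X ^ 2) * inv_one_plus_X2) +
      ((1 - fps_X ^ 3) * inv_one_minus_X3) * (fps_X * (1 + fps_X + theta) * inv_one_plus_X2)"
  proof -
    have "v * u * (c * w + x * p * f) = c * v * (w * u) + (p * v) * (x * f * u)"
      for u v w x p f c :: "rat fps" by (simp add: algebra_simps)
    thus ?thesis unfolding b2pp_gf_equation .
  qed
  finally show ?thesis
    unfolding inv_one_plus_X2 inv_one_minus_X3 by (simp add: algebra_simps eval_nat_numeral)
qed

lemma triangle_period: "int (Suc (n + 8) choose 2) mod 4 = int (Suc n choose 2) mod 4"
proof -
  have "Suc (n + 8) choose 2 = (Suc n choose 2) + 4 * (2 * n + 9)"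
    by (simp add: eval_nat_numeral)
  hence "int (Suc (n + 8) choose 2) = int (Suc n choose 2) + 4 * (2 * int n + 9)" by simp
  thus ?thesis by (simp only: mod_mult_self2)
qed

text \<open>For \<open>u = Re i\<^bsup>s\<^esup>\<close> and \<open>v = Re i\<^bsup>s-1\<^esup>\<close> the summands repeat \<open>-u, -v, -v, -u, u, v, v, u\<close>, and exactly
one of \<open>u\<close>, \<open>v\<close> is nonzero, with value \<open>1\<close> or \<open>-1\<close>. Started at \<open>u + v\<close>, the partial sums are
\<open>v, 0, -v, -u - v, -v, 0, v, u + v\<close>, after which they repeat.\<close>

lemma theta_walk_bounded:
  "re_i_power s + re_i_power (s - 1) + (\<Sum>n\<le>N. chi n * re_i_power (s - int (Suc n choose 2))) \<in> {-1, 0, 1}"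
proof -
  define a where "a n = chi n * re_i_power (s - int (Suc n choose 2))" for n
  define u where "u = re_i_power s"
  define v where "v = re_i_power (s - 1)"
  have uv: "(u, v) \<in> {(1, 0), (-1, 0), (0, 1), (0, -1)}"
    by (auto simp: u_def v_def re_i_power_def; presburger)
  have period: "a (n + 8) = a n" for n
  proof -
    have "(n + 8) mod 4 = n mod 4" by presburger
    hence "chi (n + 8) = chi n" by (simp add: chi_def)
    moreover have "re_i_power (s - int (Suc (n + 8) choose 2)) = re_i_power (s - int (Suc n choose 2))"
      by (rule re_i_power_cong) (metis triangle_period mod_diff_right_eq)
    ultimately show ?thesis by (simp only: a_def)
  qed
  have "re_i_power (s - 6) = re_i_power (s - 2)" "re_i_power (s - 10) = re_i_power (s - 2)"
    "re_i_power (s - 28) = re_i_power s" "re_i_power (s - 3) = re_i_power (s - 1 - 2)"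
    "re_i_power (s - 15) = re_i_power (s - 1 - 2)" "re_i_power (s - 21) = re_i_power (s - 1)"
    by (rule re_i_power_cong; presburger)+
  hence a: "a 0 = - u" "a 1 = - v" "a 2 = - v" "a 3 = - u" "a 4 = u" "a 5 = v" "a 6 = v" "a 7 = u"
    unfolding re_i_power_minus_2
    by (simp_all add: a_def chi_def choose_two u_def v_def)
  note a' = a a(2)[unfolded One_nat_def]
  have zero: "(\<Sum>n<8. a n) = 0"
    by (simp add: lessThan_nat_numeral a')
  have shift: "(\<Sum>n\<le>M + 8. a n) = (\<Sum>n\<le>M. a n)" for M
  proof (induction M)
    case 0
    have "{..8::nat} = insert 8 {..<8}" by auto
    thus ?case using zero period[of 0] by simp
  next
    case (Suc M)
    have "{..Suc M + 8} = insert (Suc M + 8) {..M + 8}" by auto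
    thus ?case using Suc period[of "Suc M"] by simp
  qed
  have "u + v + (\<Sum>n\<le>N. a n) \<in> {-1, 0, 1}"
  proof (induction N rule: less_induct)
    case (less N)
    show ?case
    proof (cases "N < 8")
      case True
      hence "N \<in> {0, 1, 2, 3, 4, 5, 6, 7}" by auto
      hence "u + v + (\<Sum>n\<le>N. a n) \<in> {v, 0, - v, - u - v, u + v}"
        by (elim insertE emptyE) (simp_all add: atMost_nat_numeral a')
      thus ?thesis using uv by auto
    next
      case False
      thus ?thesis using less.IH[of "N - 8"] shift[of "N - 8"] by simp
    qed
  qed
  thus ?thesis by (simp only: a_def u_def v_def)
qed

lemma triangle_mono: "m \<le> n \<Longrightarrow> Suc m choose 2 \<le> Suc n choose 2"
  by (induction rule: dec_induct) (simp_all add: numeral_2_eq_2)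

lemma ex_triangle_interval: "\<exists>N. Suc N choose 2 \<le> m \<and> m < (Suc (Suc N) choose 2)"
proof (induction m)
  case 0
  show ?case by (rule exI[of _ 0]) (simp add: eval_nat_numeral)
next
  case (Suc m)
  then obtain N where N: "Suc N choose 2 \<le> m" "m < (Suc (Suc N) choose 2)" by blast
  show ?case
  proof (cases "Suc m < (Suc (Suc N) choose 2)")
    case True
    thus ?thesis using N by (intro exI[of _ N]) auto
  next
    case False
    thus ?thesis using N by (intro exI[of _ "Suc N"]) (auto simp: numeral_2_eq_2)
  qed
qed

text \<open>The theta terms that reach the coefficient of \<open>X\<^bsup>m\<^esup>\<close> are those with triangular exponent at most
\<open>m\<close>, and their indices form an initial segment. So the coefficient is a value of the walk above.\<close>

lemma theta_quotient_coeff: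
  "fps_nth ((1 + fps_X + theta) * inv_one_plus_X2) m \<in> {-1, 0, 1}"
proof -
  obtain N where N: "Suc N choose 2 \<le> m" "m < (Suc (Suc N) choose 2)"
    using ex_triangle_interval by blast
  have ge: "n \<le> (Suc n choose 2)" for n by (simp add: numeral_2_eq_2)
  have set: "{n \<in> {..m}. Suc n choose 2 \<le> m} = {..N}"
  proof (intro set_eqI iffI)
    fix n assume "n \<in> {n \<in> {..m}. Suc n choose 2 \<le> m}"
    hence n: "Suc n choose 2 \<le> m" by simp
    show "n \<in> {..N}"
    proof (rule ccontr)
      assume "n \<notin> {..N}"
      hence "Suc (Suc N) choose 2 \<le> Suc n choose 2" by (intro triangle_mono) auto
      with n N show False by simp
    qed
  next
    fix n assume "n \<in> {..N}"
    hence "Suc n choose 2 \<le> Suc N choose 2" by (intro triangle_mono) auto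
    with N ge[of n] show "n \<in> {n \<in> {..m}. Suc n choose 2 \<le> m}" by auto
  qed
  have "fps_nth (theta * inv_one_plus_X2) m =
      (\<Sum>n\<le>m. fps_nth (inv_one_plus_X2 * (of_int (chi n) * fps_X ^ (n choose 2))) (m - n))"
    by (simp only: theta_xseries mult.commute[of _ inv_one_plus_X2] xseries_mult_left[symmetric])
      (simp add: xseries_def)
  also have "\<dots> = (\<Sum>n\<le>m. if Suc n choose 2 \<le> m
      then of_int (chi n * re_i_power (int m - int (Suc n choose 2))) else 0)"
  proof (intro sum.cong refl)
    fix n assume "n \<in> {..m}"
    moreover have "Suc n choose 2 = n + (n choose 2)" by (simp add: numeral_2_eq_2)
    moreover have "fps_nth (inv_one_plus_X2 * (of_int (chi n) * fps_X ^ (n choose 2))) (m - n) =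
        of_int (chi n) * fps_nth (fps_X ^ (n choose 2) * inv_one_plus_X2) (m - n)"
    proof -
      have "inv_one_plus_X2 * (of_int (chi n) * fps_X ^ (n choose 2)) =
          fps_const (of_int (chi n)) * (fps_X ^ (n choose 2) * inv_one_plus_X2)"
        by (simp only: fps_of_int mult_ac)
      thus ?thesis by (simp only: fps_mult_left_const_nth)
    qed
    ultimately show "fps_nth (inv_one_plus_X2 * (of_int (chi n) * fps_X ^ (n choose 2))) (m - n) =
      (if Suc n choose 2 \<le> m then of_int (chi n * re_i_power (int m - int (Suc n choose 2))) else 0)"
      by (auto simp: fps_X_power_mult_nth fps_X_power_mult_right_nth inv_one_plus_X2_def
          of_nat_diff algebra_simps)
  qed
  also have "\<dots> = (\<Sum>n\<le>N. of_int (chi n * re_i_power (int m - int (Suc n choose 2))))"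
    unfolding set[symmetric] by (rule sum.inter_filter[symmetric]) simp
  finally have theta: "fps_nth (theta * inv_one_plus_X2) m =
      of_int (\<Sum>n\<le>N. chi n * re_i_power (int m - int (Suc n choose 2)))" by simp
  \<comment> \<open>At \<open>m = 0\<close> both sides vanish, since \<open>Re i\<^bsup>-1\<^esup> = 0\<close>.\<close>
  have X: "fps_nth (fps_X * inv_one_plus_X2) m = of_int (re_i_power (int m - 1))"
    by (cases m) (simp_all add: inv_one_plus_X2_def re_i_power_def)
  define w where "w = re_i_power (int m) + re_i_power (int m - 1) +
      (\<Sum>n\<le>N. chi n * re_i_power (int m - int (Suc n choose 2)))"
  have "fps_nth ((1 + fps_X + theta) * inv_one_plus_X2) m = of_int w"
    unfolding distrib_right fps_add_nth theta X w_def by (simp add: inv_one_plus_X2_def)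
  moreover have "w \<in> {-1, 0, 1}" unfolding w_def by (rule theta_walk_bounded)
  ultimately show ?thesis by auto
qed

theorem theorem2:
  shows "(Abs_fps (\<lambda>n. of_int (b2pp n)) :: rat fps) =
      (fps_X + fps_X ^ 2 + fps_X ^ 3 - fps_X ^ 4) /
        ((1 - fps_X) * (1 + fps_X ^ 2) * (1 + fps_X + fps_X ^ 2))
      + fps_X / (1 + fps_X ^ 2) *
        (\<Sum>n. of_int (chi n) * fps_X ^ (Suc n choose 2))
    \<and> (\<forall>n>0. b2pp n \<in> {-1, 0, 1, 2})"
proof
  define X where "X = (fps_X :: rat fps)"
  define U where "U = inv_one_plus_X2"
  define V where "V = inv_one_minus_X3"
  have U: "(1 + X ^ 2) * U = 1" and V: "(1 - X ^ 3) * V = 1"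
    using inv_one_plus_X2 inv_one_minus_X3 by (simp_all add: X_def U_def V_def)
  have div: "f / g = f * h" if "g * h = 1" for f g h :: "rat fps"
  proof -
    have "g \<noteq> 0" using that by auto
    moreover have "f = (f * h) * g" using that by (simp add: mult_ac)
    ultimately show ?thesis by (metis nonzero_mult_div_cancel_right)
  qed
  have cube: "(1 - X) * (1 + X ^ 2) * (1 + X + X ^ 2) = (1 - X ^ 3) * (1 + X ^ 2)"
    by (simp add: algebra_simps eval_nat_numeral)
  have "(1 - X) * (1 + X ^ 2) * (1 + X + X ^ 2) * (U * V) = ((1 + X ^ 2) * U) * ((1 - X ^ 3) * V)"
    unfolding cube by (simp only: mult_ac)
  hence inv: "(1 - X) * (1 + X ^ 2) * (1 + X + X ^ 2) * (U * V) = 1" by (simp only: U V mult_1)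
  have "X * (X ^ 2 * V + (1 + X + theta) * U) =
      X ^ 3 * V * ((1 + X ^ 2) * U) + (X + X ^ 2) * U * ((1 - X ^ 3) * V) + X * U * theta"
    unfolding U V by (simp add: algebra_simps eval_nat_numeral)
  also have "\<dots> = (X + X ^ 2 + X ^ 3 - X ^ 4) * (U * V) + X * U * theta"
    by (simp add: algebra_simps eval_nat_numeral)
  finally show "(Abs_fps (\<lambda>n. of_int (b2pp n)) :: rat fps) =
      (fps_X + fps_X ^ 2 + fps_X ^ 3 - fps_X ^ 4) /
        ((1 - fps_X) * (1 + fps_X ^ 2) * (1 + fps_X + fps_X ^ 2))
      + fps_X / (1 + fps_X ^ 2) *
        (\<Sum>n. of_int (chi n) * fps_X ^ (Suc n choose 2))"
    unfolding b2pp_gf_split theta_def[symmetric] unfolding X_def[symmetric] div[OF inv] div[OF U]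
    by (simp only: U_def V_def)
  show "\<forall>n>0. b2pp n \<in> {-1, 0, 1, 2}"
  proof (intro allI impI)
    fix n :: nat assume "n > 0"
    then obtain m where m: "n = Suc m" by (cases n) auto
    define c where "c = fps_nth ((1 + fps_X + theta) * inv_one_plus_X2) m"
    have c: "c \<in> {-1, 0, 1}" unfolding c_def by (rule theta_quotient_coeff)
    have v: "fps_nth (fps_X ^ 2 * inv_one_minus_X3) m \<in> {0, 1}"
      by (simp add: fps_X_power_mult_nth inv_one_minus_X3_def)
    have "of_int (b2pp n) = fps_nth (Abs_fps (\<lambda>n. of_int (b2pp n)) :: rat fps) n" by simp
    also have "\<dots> = fps_nth (fps_X ^ 2 * inv_one_minus_X3) m + c"
      unfolding b2pp_gf_split m c_def by simp
    finally have "(of_int (b2pp n) :: rat) \<in> of_int ` {-1, 0, 1, 2}" using c v by auto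
    thus "b2pp n \<in> {-1, 0, 1, 2}" by (auto simp: of_int_eq_iff)
  qed
qed

end
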